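(* Let $\Omega\subset\mathbb R^3$ be a bounded domain of class $C^2$, let $\mu>0$, $g>0$, and let $\bar\rho$ be a steady density profile satisfying $\bar\rho\in C^2(\bar\Omega)$, $\inf_{\mathbf x\in\Omega}\bar\rho(\mathbf x)>0$ and $\inf_{\mathbf x\in\Omega}\bar\rho'(\mathbf x)>0$. Let $\Lambda>0$ be the unique positive number with $$\Lambda^2=\sup_{\tilde{\mathbf w}\in\mathcal A}\Big(g\int_\Omega\bar\rho'\tilde w_3^2\,d\mathbf x-\Lambda\mu\int_\Omega|\nabla\tilde{\mathbf w}|^2\,d\mathbf x\Big),\qquad \mathcal A=\Big\{\tilde{\mathbf w}\in H^\sigma_0:\ \int_\Omega\bar\rho|\tilde{\mathbf w}|^2\,d\mathbf x=1\Big\},$$ and let $$\Lambda_{\mathrm N}:=\sup_{(\tilde\rho,\tilde{\mathbf v})\in\mathcal A_{\mathrm N}}\Big[-\int_\Omega\Big(\frac{\mu|\nabla\tilde{\mathbf v}|^2}{g}+2\tilde\rho\tilde v_3\Big)d\mathbf x\Big],\qquad \mathcal A_{\mathrm N}=\Big\{(\tilde\rho,\tilde{\mathbf v})\in L^2\times H^\sigma_0:\ \int_\Omega\Big(\frac{\tilde\rho^2}{\bar\rho'}+\frac{\bar\rho|\tilde{\mathbf v}|^2}{g}\Big)d\mathbf x=1\Big\}.$$ Then $\Lambda=\Lambda_{\mathrm N}$.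
   Context: Steady density profile: a function $\bar\rho$ on $\Omega$ for which there is a steady pressure $\bar p$ with $\nabla\bar p=-g\bar\rho\,\mathbf e_3$ in $\Omega$, $\mathbf e_3=(0,0,1)$; thus $\bar\rho$ varies only with $x_3$ ($\partial_{x_1}\bar\rho=\partial_{x_2}\bar\rho=0$), and $\bar\rho':=\partial_{x_3}\bar\rho$. $L^2=L^2(\Omega)$, $H^\sigma_0:=\{\mathbf v\in W^{1,2}_0(\Omega)^3:\operatorname{div}\mathbf v=0\}$. Subscript $3$ denotes the third component of a vector. The existence and uniqueness of $\Lambda>0$ solving the displayed fixed-point equation is established beforehand in the paper. *)

theory Defs
  imports "HOL-Analysis.Analysis"
begin

section \<open>Classical differentiability\<close>

definition partial :: "'n::finite \<Rightarrow> (real^'n \<Rightarrow> real) \<Rightarrow> real^'n \<Rightarrow> real" where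
  "partial i f x = frechet_derivative f (at x) (axis i 1)"

text \<open>\<open>C_on k S f\<close>: \<open>f\<close> is of class \<open>C\<^sup>k\<close> on \<open>S\<close>; meant for open \<open>S\<close>.\<close>

primrec C_on :: "nat \<Rightarrow> (real^'n::finite) set \<Rightarrow> (real^'n \<Rightarrow> real) \<Rightarrow> bool" where
  "C_on 0 S f \<longleftrightarrow> continuous_on S f"
| "C_on (Suc k) S f \<longleftrightarrow> (\<forall>x\<in>S. f differentiable (at x)) \<and> (\<forall>i. C_on k S (partial i f))"

text \<open>\<open>C_closure k \<Omega> f\<close>: \<open>f\<close> belongs to \<open>C\<^sup>k\<close> of the closure of the open set \<open>\<Omega>\<close>, that is, all
  partial derivatives of order at most \<open>k\<close> exist in \<open>\<Omega>\<close> and extend continuously to the closure.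
  The values of \<open>f\<close> itself off \<open>\<Omega>\<close> play no role.\<close>

primrec C_closure :: "nat \<Rightarrow> (real^'n::finite) set \<Rightarrow> (real^'n \<Rightarrow> real) \<Rightarrow> bool" where
  "C_closure 0 \<Omega> f \<longleftrightarrow> (\<exists>h. continuous_on (closure \<Omega>) h \<and> (\<forall>x\<in>\<Omega>. h x = f x))"
| "C_closure (Suc k) \<Omega> f \<longleftrightarrow>
     (\<exists>h. continuous_on (closure \<Omega>) h \<and> (\<forall>x\<in>\<Omega>. h x = f x)) \<and>
     (\<forall>x\<in>\<Omega>. f differentiable (at x)) \<and> (\<forall>i. C_closure k \<Omega> (partial i f))"

text \<open>Near each boundary point, and after an orthogonal change of coordinates, the domain is the
  region strictly above the graph of a \<open>C\<^sup>2\<close> function of the first two coordinates.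
  Translations are absorbed into \<open>\<gamma>\<close>.\<close>

definition C2_boundary :: "(real^3) set \<Rightarrow> bool" where
  "C2_boundary \<Omega> \<longleftrightarrow>
     (\<forall>x0\<in>frontier \<Omega>. \<exists>r>0. \<exists>Q::real^3 \<Rightarrow> real^3. \<exists>\<gamma>::real^2 \<Rightarrow> real.
        orthogonal_transformation Q \<and> C_on 2 UNIV \<gamma> \<and>
        \<Omega> \<inter> ball x0 r = {x \<in> ball x0 r. Q x $ 3 > \<gamma> (vector [Q x $ 1, Q x $ 2])})"

definition bounded_C2_domain :: "(real^3) set \<Rightarrow> bool" where
  "bounded_C2_domain \<Omega> \<longleftrightarrow>
     open \<Omega> \<and> connected \<Omega> \<and> \<Omega> \<noteq> {} \<and> bounded \<Omega> \<and> C2_boundary \<Omega>"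

definition steady_density_profile :: "real \<Rightarrow> (real^3) set \<Rightarrow> (real^3 \<Rightarrow> real) \<Rightarrow> bool" where
  "steady_density_profile g \<Omega> \<rho> \<longleftrightarrow>
     (\<exists>p::real^3 \<Rightarrow> real. \<forall>x\<in>\<Omega>. GDERIV p x :> (- (g * \<rho> x)) *\<^sub>R axis 3 1)"


section \<open>Lebesgue and Sobolev spaces\<close>

text \<open>Elements of the function spaces are represented by functions on the whole space of which
  only the restriction to \<open>\<Omega>\<close>, up to null sets, is relevant.\<close>

definition L2 :: "(real^3) set \<Rightarrow> (real^3 \<Rightarrow> real) set" where
  "L2 \<Omega> = {u \<in> borel_measurable (lebesgue_on \<Omega>). integrable (lebesgue_on \<Omega>) (\<lambda>x. (u x)\<^sup>2)}"

definition locally_integrable :: "(real^3) set \<Rightarrow> (real^3 \<Rightarrow> real) \<Rightarrow> bool" where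
  "locally_integrable \<Omega> u \<longleftrightarrow> (\<forall>K. compact K \<and> K \<subseteq> \<Omega> \<longrightarrow> integrable (lebesgue_on K) u)"

definition test_functions :: "(real^3) set \<Rightarrow> (real^3 \<Rightarrow> real) set" where
  "test_functions \<Omega> =
     {\<phi>. (\<forall>k. C_on k UNIV \<phi>) \<and> compact (closure {x. \<phi> x \<noteq> 0}) \<and> closure {x. \<phi> x \<noteq> 0} \<subseteq> \<Omega>}"

definition has_weak_partial ::
    "(real^3) set \<Rightarrow> 3 \<Rightarrow> (real^3 \<Rightarrow> real) \<Rightarrow> (real^3 \<Rightarrow> real) \<Rightarrow> bool" where
  "has_weak_partial \<Omega> i u h \<longleftrightarrow>
     locally_integrable \<Omega> u \<and> locally_integrable \<Omega> h \<and>
     (\<forall>\<phi>\<in>test_functions \<Omega>.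
        (LINT x|lebesgue_on \<Omega>. u x * partial i \<phi> x) = - (LINT x|lebesgue_on \<Omega>. h x * \<phi> x))"

text \<open>The weak derivative is determined only almost everywhere on \<open>\<Omega>\<close>; this picks a representative.\<close>

definition weak_partial :: "(real^3) set \<Rightarrow> 3 \<Rightarrow> (real^3 \<Rightarrow> real) \<Rightarrow> real^3 \<Rightarrow> real" where
  "weak_partial \<Omega> i u = (SOME h. has_weak_partial \<Omega> i u h)"

definition W12 :: "(real^3) set \<Rightarrow> (real^3 \<Rightarrow> real) set" where
  "W12 \<Omega> = {u \<in> L2 \<Omega>. \<forall>i. \<exists>h\<in>L2 \<Omega>. has_weak_partial \<Omega> i u h}"

definition W12_norm :: "(real^3) set \<Rightarrow> (real^3 \<Rightarrow> real) \<Rightarrow> real" where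
  "W12_norm \<Omega> u = sqrt ((LINT x|lebesgue_on \<Omega>. (u x)\<^sup>2)
                        + (\<Sum>i\<in>UNIV. LINT x|lebesgue_on \<Omega>. (weak_partial \<Omega> i u x)\<^sup>2))"

text \<open>The closure of the test functions in \<open>W12\<close>.\<close>

definition W12_0 :: "(real^3) set \<Rightarrow> (real^3 \<Rightarrow> real) set" where
  "W12_0 \<Omega> = {u \<in> W12 \<Omega>. \<exists>\<phi>::nat \<Rightarrow> real^3 \<Rightarrow> real. (\<forall>n. \<phi> n \<in> test_functions \<Omega>) \<and>
                 (\<lambda>n. W12_norm \<Omega> (\<lambda>x. u x - \<phi> n x)) \<longlonglongrightarrow> 0}"

text \<open>Rows are indexed by the component, columns by the direction of differentiation. The norm on
  \<^typ>\<open>real^3^3\<close> is the Frobenius norm.\<close>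

definition weak_grad :: "(real^3) set \<Rightarrow> (real^3 \<Rightarrow> real^3) \<Rightarrow> real^3 \<Rightarrow> real^3^3" where
  "weak_grad \<Omega> v x = (\<chi> j i. weak_partial \<Omega> i (\<lambda>y. v y $ j) x)"

definition weak_div :: "(real^3) set \<Rightarrow> (real^3 \<Rightarrow> real^3) \<Rightarrow> real^3 \<Rightarrow> real" where
  "weak_div \<Omega> v x = trace (weak_grad \<Omega> v x)"

definition H_sigma_0 :: "(real^3) set \<Rightarrow> (real^3 \<Rightarrow> real^3) set" where
  "H_sigma_0 \<Omega> = {v. (\<forall>j. (\<lambda>x. v x $ j) \<in> W12_0 \<Omega>) \<and> (AE x in lebesgue_on \<Omega>. weak_div \<Omega> v x = 0)}"


section \<open>The variational problems\<close>

definition adm :: "(real^3) set \<Rightarrow> (real^3 \<Rightarrow> real) \<Rightarrow> (real^3 \<Rightarrow> real^3) set" where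
  "adm \<Omega> \<rho> = {w \<in> H_sigma_0 \<Omega>. (LINT x|lebesgue_on \<Omega>. \<rho> x * (norm (w x))\<^sup>2) = 1}"

definition adm_N ::
    "real \<Rightarrow> (real^3) set \<Rightarrow> (real^3 \<Rightarrow> real) \<Rightarrow> ((real^3 \<Rightarrow> real) \<times> (real^3 \<Rightarrow> real^3)) set" where
  "adm_N g \<Omega> \<rho> = {(\<sigma>, v). \<sigma> \<in> L2 \<Omega> \<and> v \<in> H_sigma_0 \<Omega> \<and>
     (LINT x|lebesgue_on \<Omega>. (\<sigma> x)\<^sup>2 / partial 3 \<rho> x + \<rho> x * (norm (v x))\<^sup>2 / g) = 1}"

text \<open>Suprema are taken in the extended reals, so that no junk value can arise from an empty or
  unbounded set.\<close>

definition growth_sup ::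
    "real \<Rightarrow> real \<Rightarrow> (real^3) set \<Rightarrow> (real^3 \<Rightarrow> real) \<Rightarrow> real \<Rightarrow> ereal" where
  "growth_sup \<mu> g \<Omega> \<rho> s =
     (SUP w\<in>adm \<Omega> \<rho>. ereal (g * (LINT x|lebesgue_on \<Omega>. partial 3 \<rho> x * (w x $ 3)\<^sup>2)
                           - s * \<mu> * (LINT x|lebesgue_on \<Omega>. (norm (weak_grad \<Omega> w x))\<^sup>2)))"

definition Lambda_N :: "real \<Rightarrow> real \<Rightarrow> (real^3) set \<Rightarrow> (real^3 \<Rightarrow> real) \<Rightarrow> ereal" where
  "Lambda_N \<mu> g \<Omega> \<rho> =
     (SUP (\<sigma>, v)\<in>adm_N g \<Omega> \<rho>.
        ereal (- (LINT x|lebesgue_on \<Omega>. \<mu> * (norm (weak_grad \<Omega> v x))\<^sup>2 / g + 2 * \<sigma> x * (v x $ 3))))"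

end

(* For a velocity v, the best density sigma in the second problem is found pointwise: by Young's
   inequality, - 2 sigma v_3 <= Lambda sigma^2 / rho' + rho' v_3^2 / Lambda, with equality for
   sigma = - rho' v_3 / Lambda. The remaining terms in v form g^-1 Lambda^-1 times the functional of
   the first problem, which by homogeneity is at most Lambda^2 times the integral of rho |v|^2, and
   nearly equal to it along a maximising sequence.

   The homogeneity of the functional and of the space needs weak derivatives of c v to be c times
   those of v. As weak_partial is chosen by Hilbert's operator, this rests on uniqueness of weak
   derivatives up to null sets, obtained by testing with bumps that approximate indicators of boxes. *)
theory Submission
  imports Defs
begin

section \<open>Smooth bump functions\<close>

text \<open>The case \<open>p = 1\<close> is the classical smooth function
  \<open>exp (- 1 / t)\<close> that vanishes for t <= 0. The polynomial in 1 / t is carried along so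
  that the derivatives stay in the same family.\<close>

definition flat :: "real poly \<Rightarrow> real \<Rightarrow> real" where
  "flat p t = (if t > 0 then poly p (1 / t) * exp (- (1 / t)) else 0)"

lemma poly_times_exp_tendsto_0: "((\<lambda>y. poly p y * exp (- y)) \<longlongrightarrow> (0::real)) at_top"
proof -
  have "((\<lambda>y. \<Sum>i\<le>degree p. coeff p i * (y ^ i / exp y)) \<longlongrightarrow> (\<Sum>i\<le>degree p. coeff p i * 0)) at_top"
    by (intro tendsto_intros tendsto_power_div_exp_0)
  then show ?thesis
    by (simp add: poly_altdef sum_distrib_right sum_divide_distrib exp_minus field_simps)
qed

lemma flat_tendsto_0: "(flat p \<longlongrightarrow> 0) (at_right 0)"
proof -
  have "((\<lambda>t. poly p (inverse t) * exp (- inverse t)) \<longlongrightarrow> 0) (at_right 0)"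
    by (rule filterlim_compose[OF poly_times_exp_tendsto_0 filterlim_inverse_at_top_right])
  then show ?thesis
    by (rule Lim_transform_eventually)
       (auto simp: flat_def inverse_eq_divide eventually_at_filter)
qed

text \<open>For t > 0, differentiating p(1/t) exp(-1/t) gives (1/t)^2 (p - p')(1/t) exp(-1/t); the
  factor (1/t)^2 is absorbed into the polynomial as \<open>[:0, 0, 1:]\<close>. Only t = 0 needs a
  limit.\<close>

lemma flat_has_derivative:
  "(flat p has_real_derivative flat ([:0, 0, 1:] * (p - pderiv p)) t) (at t)"
proof -
  let ?q = "[:0, 0, 1:] * (p - pderiv p)"
  consider "t > 0" | "t < 0" | "t = 0" by linarith
  then show ?thesis
  proof cases
    case 1
    have "((\<lambda>t. poly p (1 / t) * exp (- (1 / t))) has_real_derivative flat ?q t) (at t)"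
      using 1 by (auto intro!: derivative_eq_intros simp: flat_def field_simps power2_eq_square)
    then show ?thesis
      by (rule has_field_derivative_transform_within_open[where S = "{0<..}"])
         (use 1 in \<open>auto simp: flat_def\<close>)
  next
    case 2
    have "((\<lambda>t. 0) has_real_derivative flat ?q t) (at t)"
      using 2 by (simp add: flat_def)
    then show ?thesis
      by (rule has_field_derivative_transform_within_open[where S = "{..<0}"])
         (use 2 in \<open>auto simp: flat_def\<close>)
  next
    case 3
    have "((\<lambda>h. flat p h / h) \<longlongrightarrow> 0) (at 0)"
    proof (rule filterlim_split_at)
      show "((\<lambda>h. flat p h / h) \<longlongrightarrow> 0) (at_right 0)"
        \<comment> \<open>Dividing by h multiplies the polynomial in 1 / h by its variable, so the
          difference quotient at 0 is again a member of the family.\<close>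
        using flat_tendsto_0[of "pCons 0 p"]
        by (rule Lim_transform_eventually) (auto simp: flat_def eventually_at_filter)
      show "((\<lambda>h. flat p h / h) \<longlongrightarrow> 0) (at_left 0)"
        by (rule Lim_transform_eventually[OF tendsto_const])
           (auto simp: flat_def eventually_at_filter)
    qed
    then show ?thesis
      using 3 by (simp add: DERIV_def flat_def)
  qed
qed

text \<open>A class of functions closed under partial derivatives, so that differentiability of its
  members already makes all of them smooth.\<close>

inductive smooth_flat :: "(real^'n::finite \<Rightarrow> real) \<Rightarrow> bool" where
  const: "smooth_flat (\<lambda>x. c)"
| flat: "smooth_flat (\<lambda>x. flat p (\<alpha> * x $ i + \<beta>))"
| add: "smooth_flat f \<Longrightarrow> smooth_flat h \<Longrightarrow> smooth_flat (\<lambda>x. f x + h x)"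
| mult: "smooth_flat f \<Longrightarrow> smooth_flat h \<Longrightarrow> smooth_flat (\<lambda>x. f x * h x)"

lemma partialI: "(f has_derivative D) (at x) \<Longrightarrow> partial i f x = D (axis i 1)"
  by (metis frechet_derivative_at partial_def)

lemma smooth_flat_partial:
  fixes f :: "real^'n::finite \<Rightarrow> real"
  shows "smooth_flat f \<Longrightarrow> (\<forall>x. f differentiable (at x)) \<and> (\<forall>i. smooth_flat (partial i f))"
proof (induction rule: smooth_flat.induct)
  case (const c)
  have "partial i (\<lambda>x::real^'n. c) = (\<lambda>x. 0)" for i
    by (rule ext, subst partialI[OF has_derivative_const]) simp
  then show ?case by (auto intro: smooth_flat.const)
next
  case (flat p \<alpha> j \<beta>)
  let ?q = "[:0, 0, 1:] * (p - pderiv p)"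
  have d: "((\<lambda>x::real^'n. flat p (\<alpha> * x $ j + \<beta>)) has_derivative
        (\<lambda>v. flat ?q (\<alpha> * x $ j + \<beta>) * (\<alpha> * v $ j))) (at x)" for x
  proof -
    have "((\<lambda>x::real^'n. \<alpha> * x $ j + \<beta>) has_derivative (\<lambda>v. \<alpha> * v $ j)) (at x)"
      by (auto intro!: derivative_eq_intros bounded_linear_imp_has_derivative bounded_linear_vec_nth)
    from has_derivative_compose[OF this flat_has_derivative[unfolded has_field_derivative_def]]
    show ?thesis .
  qed
  have "partial i (\<lambda>x::real^'n. flat p (\<alpha> * x $ j + \<beta>)) =
      (\<lambda>x. flat ?q (\<alpha> * x $ j + \<beta>) * (\<alpha> * axis i 1 $ j))" for i
    by (rule ext, rule partialI[OF d])
  then show ?case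
    using d by (auto intro!: smooth_flat.intros simp: differentiable_def)
next
  case (add f h)
  have d: "((\<lambda>x. f x + h x) has_derivative
      (\<lambda>v. frechet_derivative f (at x) v + frechet_derivative h (at x) v)) (at x)" for x
    using add by (intro has_derivative_add) (auto simp: frechet_derivative_works[symmetric])
  have "partial i (\<lambda>x. f x + h x) = (\<lambda>x. partial i f x + partial i h x)" for i
    by (rule ext, subst partialI[OF d]) (simp add: partial_def)
  then show ?case
    using add d by (auto intro!: smooth_flat.intros simp: differentiable_def)
next
  case (mult f h)
  have d: "((\<lambda>x. f x * h x) has_derivative
      (\<lambda>v. f x * frechet_derivative h (at x) v + frechet_derivative f (at x) v * h x)) (at x)" for x
    using mult by (intro has_derivative_mult) (auto simp: frechet_derivative_works[symmetric])
  have "partial i (\<lambda>x. f x * h x) = (\<lambda>x. f x * partial i h x + partial i f x * h x)" for i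
    by (rule ext, subst partialI[OF d]) (simp add: partial_def)
  then show ?case
    using mult d by (auto intro!: smooth_flat.intros simp: differentiable_def)
qed

lemma smooth_flat_C_on: "smooth_flat f \<Longrightarrow> C_on k UNIV f"
proof (induction k arbitrary: f)
  case 0
  then show ?case
    using smooth_flat_partial[of f]
    by (auto intro: differentiable_imp_continuous_on simp: differentiable_on_def)
next
  case (Suc k)
  then show ?case using smooth_flat_partial[of f] by auto
qed

lemma smooth_flat_prod:
  "finite J \<Longrightarrow> (\<And>j. j \<in> J \<Longrightarrow> smooth_flat (f j)) \<Longrightarrow> smooth_flat (\<lambda>x. \<Prod>j\<in>J. f j x)"
  by (induction rule: finite_induct) (auto intro: smooth_flat.intros)

text \<open>Each coordinate contributes two factors, one for each face of the box. The scaling by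
  \<open>Suc n\<close> leaves the support unchanged and drives every factor exp(-1/((n+1)t)) to 1
  inside the box.\<close>

definition box_bump :: "real^'n::finite \<Rightarrow> real^'n \<Rightarrow> nat \<Rightarrow> real^'n \<Rightarrow> real" where
  "box_bump a b n x = (\<Prod>i\<in>UNIV. flat 1 (real (Suc n) * (x $ i - a $ i)) *
                                 flat 1 (real (Suc n) * (b $ i - x $ i)))"

lemma flat_one_range: "0 \<le> flat 1 t" "flat 1 t \<le> 1"
  by (auto simp: flat_def)

lemma box_bump_range: "0 \<le> box_bump a b n x" "box_bump a b n x \<le> 1"
  unfolding box_bump_def by (auto intro!: prod_nonneg prod_le_1 mult_le_one simp: flat_one_range)

lemma box_bump_support: "{x. box_bump a b n x \<noteq> 0} = box a b"
  by (auto simp: box_bump_def flat_def mem_box_cart zero_less_mult_iff)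

lemma flat_one_scaled_tendsto:
  "(\<lambda>n. flat 1 (real (Suc n) * t)) \<longlonglongrightarrow> (if t > 0 then 1 else 0)"
proof (cases "t > 0")
  case True
  have "(\<lambda>n. exp (- (1 / t) * inverse (real (Suc n)))) \<longlonglongrightarrow> exp (- (1 / t) * 0)"
    by (intro tendsto_intros LIMSEQ_inverse_real_of_nat)
  then show ?thesis
    using True by (simp add: flat_def zero_less_mult_iff divide_simps mult.commute)
next
  case False
  then show ?thesis by (simp add: flat_def zero_less_mult_iff)
qed

lemma box_bump_tendsto:
  fixes a :: "real^'n::finite"
  shows "(\<lambda>n. box_bump a b n x) \<longlonglongrightarrow> indicator (box a b) x"
proof -
  have "(\<lambda>n. box_bump a b n x) \<longlonglongrightarrow>
     (\<Prod>i\<in>UNIV. (if x $ i - a $ i > 0 then 1 else 0) * (if b $ i - x $ i > 0 then 1 else (0::real)))"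
    unfolding box_bump_def by (intro tendsto_intros flat_one_scaled_tendsto)
  also have "(\<Prod>i\<in>UNIV. (if x $ i - a $ i > 0 then 1 else 0) * (if b $ i - x $ i > 0 then 1 else 0)) =
      (indicator (box a b) x :: real)"
    by (auto simp: indicator_def mem_box_cart)
  finally show ?thesis .
qed

lemma box_bump_test_function:
  assumes "cbox a b \<subseteq> \<Omega>"
  shows "box_bump a b n \<in> test_functions \<Omega>"
proof -
  \<comment> \<open>The arguments are expanded into affine functions of one coordinate, the only
    form that the base rule of \<open>smooth_flat\<close> accepts.\<close>
  have "smooth_flat (\<lambda>x. flat 1 (real (Suc n) * x $ i + - real (Suc n) * a $ i) *
                         flat 1 (- real (Suc n) * x $ i + real (Suc n) * b $ i))" for i
    by (intro smooth_flat.intros)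
  from smooth_flat_prod[of UNIV, OF finite this]
  have "smooth_flat (box_bump a b n)"
    by (simp add: box_bump_def[abs_def] algebra_simps)
  moreover have "closure (box a b) \<subseteq> cbox a b"
    by (simp add: box_subset_cbox closed_cbox closure_minimal)
  ultimately show ?thesis
    using assms by (auto simp: test_functions_def box_bump_support intro: smooth_flat_C_on bounded_box)
qed


section \<open>The fundamental lemma of the calculus of variations\<close>

text \<open>Open boxes are stable under intersection and generate the Borel sets, and the sets over
  which the integral vanishes form a Dynkin system. So all Borel sets have integral zero, which
  forces the function to vanish almost everywhere.\<close>

lemma AE_zero_if_box_integrals_zero:
  fixes H :: "'a::euclidean_space \<Rightarrow> real"
  assumes H: "integrable lebesgue H"
    and zero: "\<And>a b. (LINT x|lebesgue. indicator (box a b) x * H x) = 0"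
  shows "AE x in lebesgue. H x = 0"
proof -
  \<comment> \<open>The boxes generate only the Borel sets, so \<open>H\<close> is exchanged for a
    Borel function equal to it almost everywhere.\<close>
  obtain G where G[measurable]: "G \<in> borel_measurable lborel" and "AE x in lborel. H x = G x"
    using completion_ex_borel_measurable_real[OF borel_measurable_integrable[OF H]] by blast
  then have HG: "AE x in lebesgue. H x = G x"
    by (simp add: AE_completion)
  have "integrable lebesgue G"
    using H HG by (subst integrable_cong_AE[of _ _ H]) (auto intro: borel_measurable_AE[OF _ HG])
  then have int: "integrable lborel G"
    by (simp add: integrable_completion)
  have boxes: "(LINT x|lborel. indicator (box a b) x * G x) = 0" for a b
  proof -
    have "(LINT x|lborel. indicator (box a b) x * G x) = (LINT x|lebesgue. indicator (box a b) x * G x)"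
      by (rule integral_completion[symmetric]) measurable
    also have "\<dots> = (LINT x|lebesgue. indicator (box a b) x * H x)"
    proof (rule integral_cong_AE)
      show "(\<lambda>x. indicator (box a b) x * H x) \<in> borel_measurable lebesgue"
        by (intro borel_measurable_times borel_measurable_integrable[OF H] borel_measurable_indicator) auto
      show "(\<lambda>x. indicator (box a b) x * G x) \<in> borel_measurable lebesgue"
        by (rule measurable_completion) measurable
    qed (use HG in eventually_elim, simp)
    finally show ?thesis using zero by simp
  qed
  have ind: "integrable lborel (\<lambda>x. indicator A x * G x)" if "A \<in> sets borel" for A
    using integrable_mult_indicator[OF _ int, of A] that by simp
  \<comment> \<open>The whole space is not a box; its integral is the limit over the boxes (-n,
    n)^d. The complement step of the induction relies on it.\<close>
  have total: "(LINT x|lborel. G x) = 0"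
  proof -
    have "(\<lambda>n. LINT x|lborel. indicator (box (- real n *\<^sub>R One) (real n *\<^sub>R One)) x * G x)
        \<longlonglongrightarrow> (LINT x|lborel. G x)"
    proof (rule integral_dominated_convergence[where w = "\<lambda>x. norm (G x)"])
      show "AE x in lborel. (\<lambda>n. indicator (box (- real n *\<^sub>R One) (real n *\<^sub>R One)) x * G x) \<longlonglongrightarrow> G x"
      proof (rule AE_I2)
        fix x :: 'a
        obtain N where N: "norm x < real N" using reals_Archimedean2 by blast
        have "x \<in> box (- real n *\<^sub>R One) (real n *\<^sub>R One)" if "n \<ge> N" for n
        proof -
          have "\<bar>x \<bullet> i\<bar> < real n" if "i \<in> Basis" for i
            using Basis_le_norm[OF that, of x] N \<open>n \<ge> N\<close> by linarith
          then show ?thesis by (auto simp: mem_box abs_less_iff minus_less_iff)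
        qed
        then show "(\<lambda>n. indicator (box (- real n *\<^sub>R One) (real n *\<^sub>R One)) x * G x) \<longlonglongrightarrow> G x"
          by (intro tendsto_eventually eventually_sequentiallyI[of N]) auto
      qed
    qed (use int in \<open>auto simp: indicator_def intro!: integrable_norm\<close>)
    then show ?thesis by (simp only: boxes) (simp add: LIMSEQ_const_iff)
  qed
  have "set_lebesgue_integral lborel A G = 0" if "A \<in> sets lborel" for A
  proof -
    have "Int_stable (range (\<lambda>(a, b). box a b :: 'a set))"
      by (auto simp: Int_stable_def box_Int_box)
    moreover have "(range (\<lambda>(a, b). box a b)) \<subseteq> Pow (UNIV :: 'a set)"
      by auto
    moreover have "A \<in> sigma_sets UNIV (range (\<lambda>(a, b). box a b))"
      using that unfolding sets_lborel borel_eq_box by simp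
    ultimately have "(LINT x|lborel. indicator A x * G x) = 0"
    proof (induction rule: sigma_sets_induct_disjoint)
      case (basic A)
      then show ?case using boxes by auto
    next
      case empty
      then show ?case by simp
    next
      case (compl A)
      then have A[measurable]: "A \<in> sets borel"
        by (simp add: borel_eq_box)
      have "(LINT x|lborel. indicator (UNIV - A) x * G x) = (LINT x|lborel. G x - indicator A x * G x)"
        by (intro Bochner_Integration.integral_cong) (auto simp: indicator_def)
      then show ?case
        using compl total int ind[OF A] by simp
    next
      case (union F)
      then have F[measurable]: "\<And>i. F i \<in> sets borel"
        by (simp add: borel_eq_box subset_eq)
      have "(LINT x:(\<Union>i. F i)|lborel. G x) = (\<Sum>i. (LINT x:(F i)|lborel. G x))"
        using union(1) int ind[of "\<Union>i. F i"]
        by (intro lebesgue_integral_countable_add)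
           (auto simp: disjoint_family_on_def set_integrable_def)
      then show ?case
        using union.IH by (simp add: set_lebesgue_integral_def)
    qed
    then show ?thesis by (simp add: set_lebesgue_integral_def)
  qed
  then have "AE x in lborel. G x = 0"
    by (intro sigma_finite_measure.density_zero[OF sigma_finite_lborel int])
  then have "AE x in lebesgue. G x = 0"
    by (simp add: AE_completion)
  with HG show ?thesis by eventually_elim simp
qed

text \<open>\<open>h\<close> is integrable only on compact subsets, but the test function is bounded
  and lives on one of them, so the product is dominated by a multiple of |h| there.\<close>

lemma integrable_test_function_mult:
  assumes "open \<Omega>" "locally_integrable \<Omega> h" "\<phi> \<in> test_functions \<Omega>"
  shows "integrable (lebesgue_on \<Omega>) (\<lambda>x. h x * \<phi> x)"
proof -
  let ?K = "closure {x. \<phi> x \<noteq> 0}"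
  have K: "compact ?K" "?K \<subseteq> \<Omega>" and C: "C_on 0 UNIV \<phi>"
    using assms(3) unfolding test_functions_def by blast+
  then have cont: "continuous_on UNIV \<phi>" by simp
  obtain B where B: "\<And>x. x \<in> ?K \<Longrightarrow> \<bar>\<phi> x\<bar> \<le> B"
    using compact_imp_bounded[OF compact_continuous_image[OF continuous_on_subset[OF cont] K(1)]]
    unfolding bounded_iff by auto
  have off: "\<phi> x = 0" if "x \<notin> ?K" for x
    using that closure_subset[of "{x. \<phi> x \<noteq> 0}"] by auto
  have "integrable (lebesgue_on ?K) h"
    using assms(2) K unfolding locally_integrable_def by blast
  then have hK: "integrable lebesgue (\<lambda>x. indicator ?K x * h x)"
    using K(1) by (subst (asm) integrable_restrict_space) (auto simp: compact_imp_closed)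
  have "\<phi> \<in> borel_measurable lebesgue"
    using borel_measurable_continuous_onI[OF cont] by (simp add: measurable_completion)
  then have "integrable lebesgue (\<lambda>x. (indicator ?K x * h x) * \<phi> x)"
    by (intro Bochner_Integration.integrable_bound[OF integrable_mult_left[OF hK, of B]]
        borel_measurable_times borel_measurable_integrable[OF hK] AE_I2)
       (auto simp: indicator_def abs_mult intro!: mult_left_mono order_trans[OF B abs_ge_self])
  also have "(\<lambda>x. (indicator ?K x * h x) * \<phi> x) = (\<lambda>x. indicator \<Omega> x *\<^sub>R (h x * \<phi> x))"
  proof
    fix x
    show "(indicator ?K x * h x) * \<phi> x = indicator \<Omega> x *\<^sub>R (h x * \<phi> x)"
      using K(2) off[of x] by (cases "x \<in> ?K") (simp_all add: indicator_def subset_iff)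
  qed
  finally show ?thesis
    using assms(1) by (subst integrable_restrict_space) auto
qed

text \<open>The bumps converge to the indicator of the open box, and the products with
  \<open>h\<close> are dominated by |h| on the closed box, so the limit of the vanishing test
  integrals is the box integral. That the closed box lies in \<Omega> makes the bumps
  admissible.\<close>

lemma box_integral_zero:
  assumes \<Omega>: "open \<Omega>" and h: "locally_integrable \<Omega> h"
    and zero: "\<And>\<phi>. \<phi> \<in> test_functions \<Omega> \<Longrightarrow> (LINT x|lebesgue_on \<Omega>. h x * \<phi> x) = 0"
    and ab: "cbox a b \<subseteq> \<Omega>"
  shows "(LINT x|lebesgue. indicator (box a b) x * h x) = 0"
proof -
  have "integrable (lebesgue_on (cbox a b)) h"
    using h ab unfolding locally_integrable_def by auto
  then have hK: "integrable lebesgue (\<lambda>x. indicator (cbox a b) x * h x)"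
    by (subst (asm) integrable_restrict_space) auto
  have hB: "integrable lebesgue (\<lambda>x. indicator (box a b) x * h x)"
  proof -
    have "(\<lambda>x. indicator (box a b) x * h x) = (\<lambda>x. indicator (box a b) x *\<^sub>R (indicator (cbox a b) x * h x))"
      using box_subset_cbox[of a b] by (auto simp: fun_eq_iff indicator_def)
    then show ?thesis using integrable_mult_indicator[OF _ hK, of "box a b"] by simp
  qed
  let ?s = "\<lambda>n x. indicator \<Omega> x * (h x * box_bump a b n x)"
  have s: "integrable lebesgue (?s n)" for n
    using integrable_test_function_mult[OF \<Omega> h box_bump_test_function[OF ab]] \<Omega>
    by (subst (asm) integrable_restrict_space) auto
  have off: "box_bump a b n x = 0" if "x \<notin> box a b" for n x
    using that box_bump_support[of a b n] by auto
  have "(\<lambda>n. LINT x|lebesgue. ?s n x) \<longlonglongrightarrow> (LINT x|lebesgue. indicator (box a b) x * h x)"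
  proof (rule integral_dominated_convergence[where w = "\<lambda>x. norm (indicator (cbox a b) x * h x)"])
    show "AE x in lebesgue. (\<lambda>n. ?s n x) \<longlonglongrightarrow> indicator (box a b) x * h x"
    proof (rule AE_I2)
      fix x
      have "(\<lambda>n. ?s n x) \<longlonglongrightarrow> indicator \<Omega> x * (h x * indicator (box a b) x)"
        by (intro tendsto_intros box_bump_tendsto)
      also have "indicator \<Omega> x * (h x * indicator (box a b) x) = indicator (box a b) x * h x"
        using ab box_subset_cbox[of a b] by (auto simp: indicator_def)
      finally show "(\<lambda>n. ?s n x) \<longlonglongrightarrow> indicator (box a b) x * h x" .
    qed
    show "AE x in lebesgue. norm (?s n x) \<le> norm (indicator (cbox a b) x * h x)" for n
    proof (rule AE_I2)
      fix x
      show "norm (?s n x) \<le> norm (indicator (cbox a b) x * h x)"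
      proof (cases "x \<in> box a b")
        case True
        then have "x \<in> cbox a b" using box_subset_cbox by blast
        then show ?thesis
          using box_bump_range[of a b n x]
          by (auto simp: indicator_def abs_mult intro!: mult_left_le)
      qed (simp add: off)
    qed
  qed (use hK hB s in \<open>auto intro!: integrable_norm\<close>)
  moreover have "(LINT x|lebesgue. ?s n x) = 0" for n
    using zero[OF box_bump_test_function[OF ab, of n]] \<Omega>
    by (subst (asm) integral_restrict_space) auto
  ultimately show ?thesis by (simp add: LIMSEQ_const_iff)
qed

text \<open>\<Omega> is a countable union of closed boxes. On each of them \<open>h\<close>, cut off
  to the open box, is globally integrable with zero integral over every box; the faces left out are
  null sets.\<close>

lemma AE_zero_if_test_integrals_zero:
  assumes \<Omega>: "open \<Omega>" and h: "locally_integrable \<Omega> h"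
    and zero: "\<And>\<phi>. \<phi> \<in> test_functions \<Omega> \<Longrightarrow> (LINT x|lebesgue_on \<Omega>. h x * \<phi> x) = 0"
  shows "AE x in lebesgue_on \<Omega>. h x = 0"
proof -
  obtain D where D: "countable D" "D \<subseteq> Pow \<Omega>" "\<And>X. X \<in> D \<Longrightarrow> \<exists>a b. X = cbox a b" "\<Union>D = \<Omega>"
    using open_countable_Union_open_cbox[OF \<Omega>] by metis
  have "AE x in lebesgue. x \<in> X \<longrightarrow> h x = 0" if "X \<in> D" for X
  proof -
    obtain a b where X: "X = cbox a b" using D(3) \<open>X \<in> D\<close> by blast
    then have ab: "cbox a b \<subseteq> \<Omega>" using D(2) \<open>X \<in> D\<close> by blast
    let ?H = "\<lambda>x. indicator (box a b) x * h x"
    have "integrable (lebesgue_on (cbox a b)) h"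
      using h ab unfolding locally_integrable_def by auto
    then have hK: "integrable lebesgue (\<lambda>x. indicator (cbox a b) x * h x)"
      by (subst (asm) integrable_restrict_space) auto
    have "?H = (\<lambda>x. indicator (box a b) x *\<^sub>R (indicator (cbox a b) x * h x))"
      using box_subset_cbox[of a b] by (auto simp: fun_eq_iff indicator_def)
    then have H: "integrable lebesgue ?H"
      using integrable_mult_indicator[OF _ hK, of "box a b"] by simp
    have "(LINT x|lebesgue. indicator (box c d) x * ?H x) = 0" for c d
    proof -
      obtain l u where lu: "box c d \<inter> box a b = box l u" unfolding box_Int_box by blast
      have "(LINT x|lebesgue. indicator (box c d) x * ?H x) = (LINT x|lebesgue. indicator (box l u) x * h x)"
        unfolding lu[symmetric] by (intro Bochner_Integration.integral_cong) (auto simp: indicator_def)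
      also have "\<dots> = 0"
      \<comment> \<open>If the intersection is empty, its corners \<open>l\<close> and
        \<open>u\<close> are arbitrary and \<open>cbox l u\<close> need not lie in
        \<open>cbox a b\<close>. Otherwise \<open>cbox l u\<close> is the closure of the
        intersection.\<close>
      proof (cases "box l u = {}")
        case False
        then have "cbox l u \<subseteq> cbox a b"
          unfolding closure_box[OF False, symmetric] lu[symmetric]
          using box_subset_cbox[of a b] by (intro closure_minimal closed_cbox) blast
        then show ?thesis using box_integral_zero[OF \<Omega> h zero] ab by auto
      qed simp
      finally show ?thesis .
    qed
    from AE_zero_if_box_integrals_zero[OF H this]
    have "AE x in lebesgue. ?H x = 0" .
    moreover have "AE x in lebesgue. x \<notin> cbox a b - box a b"
      by (rule AE_not_in[OF negligible_frontier_interval[of a b, unfolded negligible_iff_null_sets]])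
    ultimately show ?thesis unfolding X by eventually_elim (auto simp: indicator_def)
  qed
  then have "AE x in lebesgue. \<forall>X\<in>D. x \<in> X \<longrightarrow> h x = 0"
    unfolding AE_ball_countable[OF D(1)] by blast
  then have "AE x in lebesgue. x \<in> \<Omega> \<longrightarrow> h x = 0"
    by eventually_elim (use D(4) in auto)
  then show ?thesis using \<Omega> by (simp add: AE_restrict_space_iff)
qed


section \<open>Weak derivatives of multiples\<close>

lemma locally_integrable_diff:
  "locally_integrable \<Omega> u \<Longrightarrow> locally_integrable \<Omega> h \<Longrightarrow> locally_integrable \<Omega> (\<lambda>x. u x - h x)"
  by (simp add: locally_integrable_def)

lemma locally_integrable_scale:
  "locally_integrable \<Omega> u \<Longrightarrow> locally_integrable \<Omega> (\<lambda>x. c * u x)"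
  by (simp add: locally_integrable_def)

text \<open>Local integrability yields measurability only on compact subsets; it is glued together
  over countably many closed boxes that cover \<Omega>.\<close>

lemma locally_integrable_measurable:
  assumes "open \<Omega>" "locally_integrable \<Omega> h"
  shows "h \<in> borel_measurable (lebesgue_on \<Omega>)"
proof -
  obtain D where D: "countable D" "D \<subseteq> Pow \<Omega>" "\<And>X. X \<in> D \<Longrightarrow> \<exists>a b. X = cbox a b" "\<Union>D = \<Omega>"
    using open_countable_Union_open_cbox[OF assms(1)] by metis
  show ?thesis
  proof (rule measurable_piecewise_restrict[OF D(1)])
    fix X assume "X \<in> D"
    then obtain a b where X: "X = cbox a b" and sub: "X \<subseteq> \<Omega>" using D by blast
    then have "integrable (lebesgue_on X) h"
      using assms(2) unfolding locally_integrable_def by auto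
    moreover have "restrict_space (lebesgue_on \<Omega>) X = lebesgue_on X"
      using sub X assms(1) by (subst restrict_restrict_space) (auto simp: Int_absorb1)
    ultimately show "h \<in> borel_measurable (restrict_space (lebesgue_on \<Omega>) X)"
      by simp
    show "X \<inter> space (lebesgue_on \<Omega>) \<in> sets (lebesgue_on \<Omega>)"
      using X assms(1) by (auto simp: sets_restrict_space)
  qed (use D(4) in simp)
qed

text \<open>Every test function integrates to zero against the difference of the two candidates.
  Splitting that integral uses that both products are integrable.\<close>

lemma has_weak_partial_unique:
  assumes "open \<Omega>" and h: "has_weak_partial \<Omega> i u h" and k: "has_weak_partial \<Omega> i u k"
  shows "AE x in lebesgue_on \<Omega>. h x = k x"
proof -
  have loc: "locally_integrable \<Omega> h" "locally_integrable \<Omega> k"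
    using h k unfolding has_weak_partial_def by blast+
  have "(LINT x|lebesgue_on \<Omega>. (h x - k x) * \<phi> x) = 0" if "\<phi> \<in> test_functions \<Omega>" for \<phi>
  proof -
    have "(LINT x|lebesgue_on \<Omega>. h x * \<phi> x) = (LINT x|lebesgue_on \<Omega>. k x * \<phi> x)"
      using h[unfolded has_weak_partial_def, THEN conjunct2, THEN conjunct2, THEN bspec, OF that]
        k[unfolded has_weak_partial_def, THEN conjunct2, THEN conjunct2, THEN bspec, OF that] by linarith
    then show ?thesis
      using loc[THEN integrable_test_function_mult[OF \<open>open \<Omega>\<close> _ that]]
      by (simp add: left_diff_distrib)
  qed
  from AE_zero_if_test_integrals_zero[OF \<open>open \<Omega>\<close> locally_integrable_diff[OF loc] this]
  show ?thesis by simp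
qed

lemma has_weak_partial_weak_partial:
  "has_weak_partial \<Omega> i u h \<Longrightarrow> has_weak_partial \<Omega> i u (weak_partial \<Omega> i u)"
  unfolding weak_partial_def by (rule someI[where P = "has_weak_partial \<Omega> i u"])

lemma weak_partial_measurable:
  assumes "open \<Omega>" "has_weak_partial \<Omega> i u h"
  shows "weak_partial \<Omega> i u \<in> borel_measurable (lebesgue_on \<Omega>)"
  using has_weak_partial_weak_partial[OF assms(2)] locally_integrable_measurable[OF assms(1)]
  unfolding has_weak_partial_def by blast

lemma weak_partial_AE:
  assumes "open \<Omega>" "has_weak_partial \<Omega> i u h"
  shows "AE x in lebesgue_on \<Omega>. weak_partial \<Omega> i u x = h x"
  by (rule has_weak_partial_unique[OF assms(1) has_weak_partial_weak_partial[OF assms(2)] assms(2)])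

lemma has_weak_partial_scale:
  assumes "has_weak_partial \<Omega> i u h"
  shows "has_weak_partial \<Omega> i (\<lambda>x. c * u x) (\<lambda>x. c * h x)"
  using assms by (simp add: has_weak_partial_def locally_integrable_scale mult.assoc)

lemma weak_partial_scale:
  assumes "open \<Omega>" "has_weak_partial \<Omega> i u h"
  shows "AE x in lebesgue_on \<Omega>. weak_partial \<Omega> i (\<lambda>x. c * u x) x = c * weak_partial \<Omega> i u x"
  using weak_partial_AE[OF assms(1) has_weak_partial_scale[OF assms(2), of c]] weak_partial_AE[OF assms]
  by eventually_elim simp

text \<open>If \<open>u\<close> has no weak derivative, then neither has \<open>c u\<close>, and \<^const>\<open>weak_partial\<close> is the same
  junk function for both. Hence the factor \<open>1 + c\<^sup>2\<close> works without any assumption on \<open>u\<close>.\<close>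

lemma weak_partial_scale_square_integral:
  assumes "open \<Omega>" "c \<noteq> 0"
  shows "(LINT x|lebesgue_on \<Omega>. (weak_partial \<Omega> i (\<lambda>x. c * u x) x)\<^sup>2)
     \<le> (1 + c\<^sup>2) * (LINT x|lebesgue_on \<Omega>. (weak_partial \<Omega> i u x)\<^sup>2)"
proof (cases "\<exists>h. has_weak_partial \<Omega> i u h")
  case True
  then obtain h where h: "has_weak_partial \<Omega> i u h" by blast
  let ?I = "LINT x|lebesgue_on \<Omega>. (weak_partial \<Omega> i u x)\<^sup>2"
  have "(LINT x|lebesgue_on \<Omega>. (weak_partial \<Omega> i (\<lambda>x. c * u x) x)\<^sup>2) =
      (LINT x|lebesgue_on \<Omega>. c\<^sup>2 * (weak_partial \<Omega> i u x)\<^sup>2)"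
  proof (rule integral_cong_AE)
    show "(\<lambda>x. (weak_partial \<Omega> i (\<lambda>x. c * u x) x)\<^sup>2) \<in> borel_measurable (lebesgue_on \<Omega>)"
      using weak_partial_measurable[OF assms(1) has_weak_partial_scale[OF h]] by measurable
    show "(\<lambda>x. c\<^sup>2 * (weak_partial \<Omega> i u x)\<^sup>2) \<in> borel_measurable (lebesgue_on \<Omega>)"
      using weak_partial_measurable[OF assms(1) h] by measurable
  qed (use weak_partial_scale[OF assms(1) h, of c] in eventually_elim, simp add: power_mult_distrib)
  also have "\<dots> = c\<^sup>2 * ?I" by simp
  also have "\<dots> \<le> (1 + c\<^sup>2) * ?I" by (intro mult_right_mono) auto
  finally show ?thesis .
next
  case False
  \<comment> \<open>Multiplying a weak derivative of c u by 1 / c would give one of u.\<close>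
  have "\<not> has_weak_partial \<Omega> i (\<lambda>x. c * u x) h" for h
    using False has_weak_partial_scale[of \<Omega> i "\<lambda>x. c * u x" h "1 / c"] \<open>c \<noteq> 0\<close> by auto
  with False have "has_weak_partial \<Omega> i (\<lambda>x. c * u x) = has_weak_partial \<Omega> i u"
    by blast
  then have "weak_partial \<Omega> i (\<lambda>x. c * u x) = weak_partial \<Omega> i u"
    by (simp add: weak_partial_def)
  then show ?thesis by (simp add: distrib_right)
qed

text \<open>Meant for the differences u - \<phi>_n, whose norms tend to 0: there any fixed factor
  will do, so an inequality without regularity assumptions on \<open>u\<close> is enough.\<close>

lemma W12_norm_scale_le:
  assumes "open \<Omega>" "c \<noteq> 0"
  shows "W12_norm \<Omega> (\<lambda>x. c * u x) \<le> sqrt (1 + c\<^sup>2) * W12_norm \<Omega> u"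
proof -
  have "(LINT x|lebesgue_on \<Omega>. (c * u x)\<^sup>2) \<le> (1 + c\<^sup>2) * (LINT x|lebesgue_on \<Omega>. (u x)\<^sup>2)"
    by (simp add: power_mult_distrib mult_right_mono)
  then have "(LINT x|lebesgue_on \<Omega>. (c * u x)\<^sup>2)
        + (\<Sum>i\<in>UNIV. LINT x|lebesgue_on \<Omega>. (weak_partial \<Omega> i (\<lambda>x. c * u x) x)\<^sup>2)
      \<le> (1 + c\<^sup>2) * ((LINT x|lebesgue_on \<Omega>. (u x)\<^sup>2)
        + (\<Sum>i\<in>UNIV. LINT x|lebesgue_on \<Omega>. (weak_partial \<Omega> i u x)\<^sup>2))"
    unfolding distrib_left sum_distrib_left
    by (intro add_mono sum_mono weak_partial_scale_square_integral assms)
  then show ?thesis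
    unfolding W12_norm_def by (simp flip: real_sqrt_mult)
qed

section \<open>Invariance of the function spaces under scaling\<close>

lemma C_on_scale: "C_on k UNIV f \<Longrightarrow> C_on k UNIV (\<lambda>x. c * f x)"
proof (induction k arbitrary: f)
  case (Suc k)
  have d: "((\<lambda>x. c * f x) has_derivative (\<lambda>v. c * frechet_derivative f (at x) v)) (at x)" for x
    using Suc.prems by (intro has_derivative_mult_right) (auto simp: frechet_derivative_works[symmetric])
  have "partial i (\<lambda>x. c * f x) = (\<lambda>x. c * partial i f x)" for i
    by (rule ext, subst partialI[OF d]) (simp add: partial_def)
  moreover have "(\<lambda>x. c * f x) differentiable (at x)" for x
    using d unfolding differentiable_def by blast
  ultimately show ?case using Suc by simp
qed (auto intro: continuous_intros)

lemma test_functions_scale: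
  "\<phi> \<in> test_functions \<Omega> \<Longrightarrow> c \<noteq> 0 \<Longrightarrow> (\<lambda>x. c * \<phi> x) \<in> test_functions \<Omega>"
  by (simp add: test_functions_def C_on_scale)

lemma L2_scale: "u \<in> L2 \<Omega> \<Longrightarrow> (\<lambda>x. c * u x) \<in> L2 \<Omega>"
  by (auto simp: L2_def power_mult_distrib intro: borel_measurable_times)

lemma W12_scale:
  assumes "u \<in> W12 \<Omega>"
  shows "(\<lambda>x. c * u x) \<in> W12 \<Omega>"
proof -
  have "\<exists>h\<in>L2 \<Omega>. has_weak_partial \<Omega> i (\<lambda>x. c * u x) h" for i
  proof -
    obtain h where "h \<in> L2 \<Omega>" "has_weak_partial \<Omega> i u h"
      using assms unfolding W12_def by blast
    then show ?thesis
      by (intro bexI[of _ "\<lambda>x. c * h x"] has_weak_partial_scale L2_scale)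
  qed
  then show ?thesis
    using assms L2_scale[of u \<Omega> c] by (simp add: W12_def)
qed

text \<open>If \<phi>_n approximates u, then c \<phi>_n approximates c u, by the norm bound and
  squeezing.\<close>

lemma W12_0_scale:
  assumes "open \<Omega>" "c \<noteq> 0" "u \<in> W12_0 \<Omega>"
  shows "(\<lambda>x. c * u x) \<in> W12_0 \<Omega>"
proof -
  obtain \<phi> where \<phi>: "\<And>n. \<phi> n \<in> test_functions \<Omega>"
      "(\<lambda>n. W12_norm \<Omega> (\<lambda>x. u x - \<phi> n x)) \<longlonglongrightarrow> 0"
    using assms(3) unfolding W12_0_def by blast
  have "(\<lambda>n. W12_norm \<Omega> (\<lambda>x. c * u x - c * \<phi> n x)) \<longlonglongrightarrow> 0"
  proof (rule tendsto_sandwich[where f = "\<lambda>_. 0"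
        and h = "\<lambda>n. sqrt (1 + c\<^sup>2) * W12_norm \<Omega> (\<lambda>x. u x - \<phi> n x)"])
    show "\<forall>\<^sub>F n in sequentially. W12_norm \<Omega> (\<lambda>x. c * u x - c * \<phi> n x)
        \<le> sqrt (1 + c\<^sup>2) * W12_norm \<Omega> (\<lambda>x. u x - \<phi> n x)"
      unfolding right_diff_distrib[symmetric] by (intro always_eventually allI W12_norm_scale_le assms)
    show "(\<lambda>n. sqrt (1 + c\<^sup>2) * W12_norm \<Omega> (\<lambda>x. u x - \<phi> n x)) \<longlonglongrightarrow> 0"
      using tendsto_mult_right_zero[OF \<phi>(2)] .
    show "\<forall>\<^sub>F n in sequentially. 0 \<le> W12_norm \<Omega> (\<lambda>x. c * u x - c * \<phi> n x)"
      by (simp add: W12_norm_def sum_nonneg)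
  qed (rule tendsto_const)
  moreover have "\<And>n. (\<lambda>x. c * \<phi> n x) \<in> test_functions \<Omega>"
    using \<phi>(1) assms(2) by (rule test_functions_scale)
  moreover have "(\<lambda>x. c * u x) \<in> W12 \<Omega>"
    using assms(3) by (simp add: W12_0_def W12_scale)
  ultimately show ?thesis
    unfolding W12_0_def by (intro CollectI conjI exI[of _ "\<lambda>n x. c * \<phi> n x"] allI)
qed

lemma weak_grad_scale:
  assumes "open \<Omega>" "\<And>j. (\<lambda>x. v x $ j) \<in> W12 \<Omega>"
  shows "AE x in lebesgue_on \<Omega>. weak_grad \<Omega> (\<lambda>x. c *\<^sub>R v x) x = c *\<^sub>R weak_grad \<Omega> v x"
proof -
  have "AE x in lebesgue_on \<Omega>. \<forall>j i. weak_partial \<Omega> i (\<lambda>x. c * v x $ j) x = c * weak_partial \<Omega> i (\<lambda>x. v x $ j) x"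
    using assms weak_partial_scale[OF assms(1)] unfolding AE_all_countable W12_def by blast
  then show ?thesis
    by eventually_elim (simp add: weak_grad_def vec_eq_iff)
qed

lemma H_sigma_0_scale:
  assumes "open \<Omega>" "c \<noteq> 0" "v \<in> H_sigma_0 \<Omega>"
  shows "(\<lambda>x. c *\<^sub>R v x) \<in> H_sigma_0 \<Omega>"
proof -
  have v: "\<And>j. (\<lambda>x. v x $ j) \<in> W12_0 \<Omega>" "AE x in lebesgue_on \<Omega>. weak_div \<Omega> v x = 0"
    using assms(3) unfolding H_sigma_0_def by auto
  then have "\<And>j. (\<lambda>x. v x $ j) \<in> W12 \<Omega>"
    by (simp add: W12_0_def)
  from weak_grad_scale[OF assms(1) this, of c] v(2)
  have "AE x in lebesgue_on \<Omega>. weak_div \<Omega> (\<lambda>x. c *\<^sub>R v x) x = 0"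
    by eventually_elim (simp add: weak_div_def trace_def flip: sum_distrib_left)
  then show ?thesis
    using v(1) assms by (simp add: H_sigma_0_def W12_0_scale)
qed


section \<open>Integrability of the energy terms\<close>

lemma L2_product_integrable:
  assumes "u \<in> L2 \<Omega>" "v \<in> L2 \<Omega>"
  shows "integrable (lebesgue_on \<Omega>) (\<lambda>x. u x * v x)"
proof (rule Bochner_Integration.integrable_bound[where f = "\<lambda>x. (u x)\<^sup>2 + (v x)\<^sup>2"])
  show "AE x in lebesgue_on \<Omega>. norm (u x * v x) \<le> norm ((u x)\<^sup>2 + (v x)\<^sup>2)"
  proof (rule AE_I2)
    fix x
    have "2 * \<bar>u x\<bar> * \<bar>v x\<bar> \<le> \<bar>u x\<bar>\<^sup>2 + \<bar>v x\<bar>\<^sup>2"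
      by (rule sum_squares_bound)
    moreover have "0 \<le> \<bar>u x\<bar> * \<bar>v x\<bar>" by simp
    ultimately have "\<bar>u x\<bar> * \<bar>v x\<bar> \<le> \<bar>u x\<bar>\<^sup>2 + \<bar>v x\<bar>\<^sup>2" by linarith
    then show "norm (u x * v x) \<le> norm ((u x)\<^sup>2 + (v x)\<^sup>2)"
      by (simp add: abs_mult)
  qed
qed (use assms in \<open>auto simp: L2_def intro: borel_measurable_times\<close>)

lemma integrable_bounded_mult:
  fixes f g :: "real^3 \<Rightarrow> real"
  assumes "f \<in> borel_measurable (lebesgue_on \<Omega>)" "\<And>x. x \<in> \<Omega> \<Longrightarrow> \<bar>f x\<bar> \<le> B"
    and g: "integrable (lebesgue_on \<Omega>) g"
  shows "integrable (lebesgue_on \<Omega>) (\<lambda>x. f x * g x)"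
proof (rule Bochner_Integration.integrable_bound[OF integrable_mult_right[OF g, of B]])
  show "(\<lambda>x. f x * g x) \<in> borel_measurable (lebesgue_on \<Omega>)"
    using assms by (intro borel_measurable_times) auto
  show "AE x in lebesgue_on \<Omega>. norm (f x * g x) \<le> norm (B * g x)"
    using assms(2) by (intro AE_I2) (auto simp: abs_mult intro!: mult_right_mono[OF order_trans[OF _ abs_ge_self]])
qed

text \<open>Membership in \<open>W12\<close> provides some square integrable weak derivative;
  uniqueness carries this over to the representative chosen by \<open>weak_partial\<close>.\<close>

lemma W12_weak_partial_L2:
  assumes "open \<Omega>" "u \<in> W12 \<Omega>"
  shows "weak_partial \<Omega> i u \<in> L2 \<Omega>"
proof -
  obtain h where h: "h \<in> L2 \<Omega>" "has_weak_partial \<Omega> i u h"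
    using assms(2) unfolding W12_def by blast
  note m = weak_partial_measurable[OF assms(1) h(2)]
  have "integrable (lebesgue_on \<Omega>) (\<lambda>x. (weak_partial \<Omega> i u x)\<^sup>2) \<longleftrightarrow>
      integrable (lebesgue_on \<Omega>) (\<lambda>x. (h x)\<^sup>2)"
  proof (rule integrable_cong_AE)
    show "(\<lambda>x. (weak_partial \<Omega> i u x)\<^sup>2) \<in> borel_measurable (lebesgue_on \<Omega>)"
      using m by measurable
    show "(\<lambda>x. (h x)\<^sup>2) \<in> borel_measurable (lebesgue_on \<Omega>)"
      using h(1) by (auto simp: L2_def)
  qed (use weak_partial_AE[OF assms(1) h(2)] in eventually_elim, simp)
  then show ?thesis using h(1) m by (simp add: L2_def)
qed

lemma norm_weak_grad_square:
  "(norm (weak_grad \<Omega> v x))\<^sup>2 = (\<Sum>j\<in>UNIV. \<Sum>i\<in>UNIV. (weak_partial \<Omega> i (\<lambda>y. v y $ j) x)\<^sup>2)"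
  unfolding power2_norm_eq_inner by (simp add: weak_grad_def inner_vec_def power2_eq_square)

lemma H_sigma_0_component_W12: "v \<in> H_sigma_0 \<Omega> \<Longrightarrow> (\<lambda>x. v x $ j) \<in> W12 \<Omega>"
  by (simp add: H_sigma_0_def W12_0_def)

lemma H_sigma_0_component_L2: "v \<in> H_sigma_0 \<Omega> \<Longrightarrow> (\<lambda>x. v x $ j) \<in> L2 \<Omega>"
  using H_sigma_0_component_W12[of v \<Omega> j] by (simp add: W12_def)

lemma H_sigma_0_grad_integrable:
  assumes "open \<Omega>" "v \<in> H_sigma_0 \<Omega>"
  shows "integrable (lebesgue_on \<Omega>) (\<lambda>x. (norm (weak_grad \<Omega> v x))\<^sup>2)"
  unfolding norm_weak_grad_square
  using W12_weak_partial_L2[OF assms(1) H_sigma_0_component_W12[OF assms(2)]]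
  by (intro Bochner_Integration.integrable_sum) (simp add: L2_def)

lemma H_sigma_0_square_integrable:
  assumes "v \<in> H_sigma_0 \<Omega>"
  shows "integrable (lebesgue_on \<Omega>) (\<lambda>x. (norm (v x))\<^sup>2)"
proof -
  have "integrable (lebesgue_on \<Omega>) (\<lambda>x. \<Sum>j\<in>UNIV. (v x $ j)\<^sup>2)"
    using H_sigma_0_component_L2[OF assms] by (intro Bochner_Integration.integrable_sum) (simp add: L2_def)
  then show ?thesis
    unfolding power2_norm_eq_inner by (simp add: inner_vec_def power2_eq_square)
qed

lemma weak_grad_scale_square_integral:
  assumes "open \<Omega>" "c \<noteq> 0" "v \<in> H_sigma_0 \<Omega>"
  shows "(LINT x|lebesgue_on \<Omega>. (norm (weak_grad \<Omega> (\<lambda>x. c *\<^sub>R v x) x))\<^sup>2) =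
    c\<^sup>2 * (LINT x|lebesgue_on \<Omega>. (norm (weak_grad \<Omega> v x))\<^sup>2)"
proof -
  have "(LINT x|lebesgue_on \<Omega>. (norm (weak_grad \<Omega> (\<lambda>x. c *\<^sub>R v x) x))\<^sup>2) =
      (LINT x|lebesgue_on \<Omega>. c\<^sup>2 * (norm (weak_grad \<Omega> v x))\<^sup>2)"
  proof (rule integral_cong_AE)
    show "AE x in lebesgue_on \<Omega>. (norm (weak_grad \<Omega> (\<lambda>x. c *\<^sub>R v x) x))\<^sup>2 = c\<^sup>2 * (norm (weak_grad \<Omega> v x))\<^sup>2"
      using weak_grad_scale[OF assms(1) H_sigma_0_component_W12[OF assms(3)], of c]
      by eventually_elim (simp add: power_mult_distrib)
  qed (use H_sigma_0_grad_integrable[OF assms(1)] H_sigma_0_scale[OF assms] assms(3)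
      in \<open>auto intro!: borel_measurable_times borel_measurable_integrable\<close>)
  then show ?thesis by simp
qed

section \<open>Measurability and bounds of the coefficients\<close>

lemma C_closure_0_measurable:
  assumes "open \<Omega>" "C_closure 0 \<Omega> f"
  shows "f \<in> borel_measurable (lebesgue_on \<Omega>)"
proof -
  obtain h where h: "continuous_on (closure \<Omega>) h" "\<And>x. x \<in> \<Omega> \<Longrightarrow> h x = f x"
    using assms(2) by auto
  then have "continuous_on \<Omega> f"
    using continuous_on_subset[OF h(1) closure_subset] by (simp cong: continuous_on_cong)
  then show ?thesis
    using assms(1) by (intro continuous_imp_measurable_on_sets_lebesgue) auto
qed

text \<open>The bound comes from the continuous extension on the compact closure, which agrees with
  \<open>f\<close> on \<Omega>.\<close>

lemma C_closure_0_bounded: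
  assumes "bounded \<Omega>" "C_closure 0 \<Omega> f"
  obtains B where "\<And>x. x \<in> \<Omega> \<Longrightarrow> \<bar>f x\<bar> \<le> B"
proof -
  obtain h where h: "continuous_on (closure \<Omega>) h" "\<And>x. x \<in> \<Omega> \<Longrightarrow> h x = f x"
    using assms(2) by auto
  have "compact (closure \<Omega>)" using assms(1) by (simp add: compact_closure)
  then have "bounded (h ` closure \<Omega>)"
    using h(1) by (intro compact_imp_bounded compact_continuous_image)
  then obtain B where "\<And>x. x \<in> closure \<Omega> \<Longrightarrow> \<bar>h x\<bar> \<le> B"
    unfolding bounded_iff by auto
  then have "\<bar>f x\<bar> \<le> B" if "x \<in> \<Omega>" for x
    using that h(2)[OF that] closure_subset[of \<Omega>] by (metis subsetD)
  then show thesis by (rule that)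
qed

text \<open>A real infimum is a lower bound only for a set bounded below. This lemma turns the
  positive infima of the density and its derivative into pointwise bounds.\<close>

lemma INF_lower_bounded:
  fixes f :: "'a \<Rightarrow> real"
  assumes "\<And>x. x \<in> S \<Longrightarrow> \<bar>f x\<bar> \<le> B" "x \<in> S"
  shows "(INF x\<in>S. f x) \<le> f x"
proof (rule cINF_lower)
  show "bdd_below (f ` S)"
    using assms(1) by (intro bdd_belowI2[of _ "- B"]) (simp add: abs_le_iff minus_le_iff)
qed fact

section \<open>The two variational problems\<close>

text \<open>Homogeneity removes the normalisation from the first variational problem.\<close>

lemma growth_bound:
  assumes "open \<Omega>" and \<rho>: "\<rho> \<in> borel_measurable (lebesgue_on \<Omega>)" "\<And>x. x \<in> \<Omega> \<Longrightarrow> \<bar>\<rho> x\<bar> \<le> B"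
      "m > 0" "\<And>x. x \<in> \<Omega> \<Longrightarrow> m \<le> \<rho> x"
    and "g > 0" "\<mu> > 0" "s > 0"
    and sup: "growth_sup \<mu> g \<Omega> \<rho> s \<le> ereal L"
    and v: "v \<in> H_sigma_0 \<Omega>"
  shows "g * (LINT x|lebesgue_on \<Omega>. partial 3 \<rho> x * (v x $ 3)\<^sup>2)
       - s * \<mu> * (LINT x|lebesgue_on \<Omega>. (norm (weak_grad \<Omega> v x))\<^sup>2)
     \<le> L * (LINT x|lebesgue_on \<Omega>. \<rho> x * (norm (v x))\<^sup>2)"
proof -
  let ?M = "lebesgue_on \<Omega>"
  let ?a = "\<lambda>v. LINT x|?M. (norm (weak_grad \<Omega> v x))\<^sup>2"
  let ?b = "\<lambda>v. LINT x|?M. partial 3 \<rho> x * (v x $ 3)\<^sup>2"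
  let ?c = "\<lambda>v. LINT x|?M. \<rho> x * (norm (v x))\<^sup>2"
  have int: "integrable ?M (\<lambda>x. \<rho> x * (norm (v x))\<^sup>2)"
    by (rule integrable_bounded_mult[OF \<rho>(1,2) H_sigma_0_square_integrable[OF v]])
  have nonneg: "0 \<le> \<rho> x * (norm (v x))\<^sup>2" if "x \<in> \<Omega>" for x
    using \<rho>(3) \<rho>(4)[OF that] by simp
  have "?c v \<ge> 0"
    using nonneg by (intro integral_nonneg_AE AE_I2) simp
  then consider "?c v = 0" | "?c v > 0" by linarith
  then show ?thesis
  proof cases
    case 1
    \<comment> \<open>No normalisation is possible here. As the density is at least
      \<open>m > 0\<close>, \<open>v\<close> vanishes almost everywhere, and the gradient term that
      remains has the favourable sign.\<close>
    have "AE x in ?M. \<rho> x * (norm (v x))\<^sup>2 = 0"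
      using 1 nonneg by (subst (asm) integral_nonneg_eq_0_iff_AE[OF int]) auto
    then have "AE x in ?M. partial 3 \<rho> x * (v x $ 3)\<^sup>2 = 0"
      using AE_space by eventually_elim (use \<rho>(3,4) in force)
    then have "?b v = 0"
      by (rule integral_eq_zero_AE)
    moreover have "0 \<le> s * \<mu> * ?a v"
      using assms by simp
    ultimately show ?thesis using 1 by simp
  next
    case 2
    \<comment> \<open>This factor makes c v admissible. All three integrals scale by c^2, so the
      bound for c v becomes the claim after multiplication by \<open>?c v\<close>.\<close>
    define c where "c = 1 / sqrt (?c v)"
    have c: "c \<noteq> 0" "c\<^sup>2 = 1 / ?c v"
      using 2 by (auto simp: c_def power_divide)
    let ?w = "\<lambda>x. c *\<^sub>R v x"
    have "?c ?w = (LINT x|?M. c\<^sup>2 * (\<rho> x * (norm (v x))\<^sup>2))"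
      by (intro Bochner_Integration.integral_cong) (simp_all add: power_mult_distrib)
    then have "?c ?w = c\<^sup>2 * ?c v"
      by simp
    then have "?w \<in> adm \<Omega> \<rho>"
      using 2 c H_sigma_0_scale[OF assms(1) c(1) v] by (simp add: adm_def)
    then have "ereal (g * ?b ?w - s * \<mu> * ?a ?w) \<le> growth_sup \<mu> g \<Omega> \<rho> s"
      unfolding growth_sup_def by (rule SUP_upper)
    from order_trans[OF this sup] have "g * ?b ?w - s * \<mu> * ?a ?w \<le> L"
      by (simp only: ereal_less_eq)
    moreover
    have "?b ?w = (LINT x|?M. c\<^sup>2 * (partial 3 \<rho> x * (v x $ 3)\<^sup>2))"
      by (intro Bochner_Integration.integral_cong) (simp_all add: power_mult_distrib)
    then have "?b ?w = c\<^sup>2 * ?b v"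
      by simp
    moreover note weak_grad_scale_square_integral[OF assms(1) c(1) v]
    ultimately have "c\<^sup>2 * (g * ?b v - s * \<mu> * ?a v) \<le> L"
      by (simp only: right_diff_distrib mult_ac)
    then have "(g * ?b v - s * \<mu> * ?a v) / ?c v \<le> L"
      unfolding c(2) by simp
    then show ?thesis
      using 2 by (simp add: pos_divide_le_eq)
  qed
qed

theorem proposition3p2:
  fixes \<Omega> :: "(real^3) set" and \<rho> :: "real^3 \<Rightarrow> real" and \<mu> g \<Lambda> :: real
  assumes "bounded_C2_domain \<Omega>"
    and "\<mu> > 0" and "g > 0"
    and "steady_density_profile g \<Omega> \<rho>"
    and "C_closure 2 \<Omega> \<rho>"
    and "(INF x\<in>\<Omega>. \<rho> x) > 0"
    and "(INF x\<in>\<Omega>. partial 3 \<rho> x) > 0"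
    and "\<Lambda> > 0"
    and "ereal (\<Lambda>\<^sup>2) = growth_sup \<mu> g \<Omega> \<rho> \<Lambda>"
  shows "ereal \<Lambda> = Lambda_N \<mu> g \<Omega> \<rho>"
proof -
  let ?M = "lebesgue_on \<Omega>" and ?\<rho>' = "partial 3 \<rho>"
  let ?a = "\<lambda>v. LINT x|?M. (norm (weak_grad \<Omega> v x))\<^sup>2"
  let ?b = "\<lambda>v::real^3 \<Rightarrow> real^3. LINT x|?M. ?\<rho>' x * (v x $ 3)\<^sup>2"
  let ?c = "\<lambda>v::real^3 \<Rightarrow> real^3. LINT x|?M. \<rho> x * (norm (v x))\<^sup>2"
  have \<Omega>: "open \<Omega>" "bounded \<Omega>"
    using assms(1) by (auto simp: bounded_C2_domain_def)
  have "C_closure 0 \<Omega> \<rho>" "C_closure 0 \<Omega> ?\<rho>'"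
    using assms(5) by (auto simp: numeral_2_eq_2)
  note m0 = this[THEN C_closure_0_measurable[OF \<Omega>(1)]]
    and bnd = this[THEN C_closure_0_bounded[OF \<Omega>(2)]]
  obtain B where B: "\<And>x. x \<in> \<Omega> \<Longrightarrow> \<bar>\<rho> x\<bar> \<le> B" using bnd(1) by blast
  obtain B' where B': "\<And>x. x \<in> \<Omega> \<Longrightarrow> \<bar>?\<rho>' x\<bar> \<le> B'" using bnd(2) by blast
  define m where "m = (INF x\<in>\<Omega>. \<rho> x)"
  define m' where "m' = (INF x\<in>\<Omega>. ?\<rho>' x)"
  have m: "m > 0" "\<And>x. x \<in> \<Omega> \<Longrightarrow> m \<le> \<rho> x"
    using assms(6) INF_lower_bounded[OF B] unfolding m_def by auto
  have m': "m' > 0" "\<And>x. x \<in> \<Omega> \<Longrightarrow> m' \<le> ?\<rho>' x"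
    using assms(7) INF_lower_bounded[OF B'] unfolding m'_def by auto
  have pos': "?\<rho>' x > 0" if "x \<in> \<Omega>" for x
    using m'(1) m'(2)[OF that] by linarith
  have int_a: "integrable ?M (\<lambda>x. (norm (weak_grad \<Omega> v x))\<^sup>2)"
    and int_b: "integrable ?M (\<lambda>x. ?\<rho>' x * (v x $ 3)\<^sup>2)"
    and int_c: "integrable ?M (\<lambda>x. \<rho> x * (norm (v x))\<^sup>2)"
    if "v \<in> H_sigma_0 \<Omega>" for v
  proof -
    show "integrable ?M (\<lambda>x. (norm (weak_grad \<Omega> v x))\<^sup>2)"
      by (rule H_sigma_0_grad_integrable[OF \<Omega>(1) that])
    show "integrable ?M (\<lambda>x. ?\<rho>' x * (v x $ 3)\<^sup>2)"
      using H_sigma_0_component_L2[OF that, of 3]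
      by (intro integrable_bounded_mult[OF m0(2) B']) (simp_all add: L2_def)
    show "integrable ?M (\<lambda>x. \<rho> x * (norm (v x))\<^sup>2)"
      by (rule integrable_bounded_mult[OF m0(1) B H_sigma_0_square_integrable[OF that]])
  qed
  have int_\<sigma>: "integrable ?M (\<lambda>x. (\<sigma> x)\<^sup>2 / ?\<rho>' x)" if "\<sigma> \<in> L2 \<Omega>" for \<sigma>
  proof -
    \<comment> \<open>The lower bound \<open>m'\<close> makes the weight 1 / \<rho>'
      bounded.\<close>
    have "integrable ?M (\<lambda>x. (1 / ?\<rho>' x) * (\<sigma> x)\<^sup>2)"
    proof (rule integrable_bounded_mult[where B = "1 / m'"])
      show "(\<lambda>x. 1 / ?\<rho>' x) \<in> borel_measurable ?M" using m0(2) by measurable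
      show "\<bar>1 / ?\<rho>' x\<bar> \<le> 1 / m'" if "x \<in> \<Omega>" for x
        using m' that pos'[OF that] by (auto intro!: divide_left_mono)
    qed (use that in \<open>simp add: L2_def\<close>)
    then show ?thesis by simp
  qed
  \<comment> \<open>The integral of a non-integrable function is 0 by default, so splitting this
    integral and the next one depends on the integrability of every summand.\<close>
  have split_value: "- (LINT x|?M. \<mu> * (norm (weak_grad \<Omega> v x))\<^sup>2 / g + 2 * \<sigma> x * (v x $ 3)) =
      - (\<mu> * ?a v / g) - 2 * (LINT x|?M. \<sigma> x * (v x $ 3))"
    if "\<sigma> \<in> L2 \<Omega>" "v \<in> H_sigma_0 \<Omega>" for \<sigma> v
    using int_a[OF that(2)] L2_product_integrable[OF that(1) H_sigma_0_component_L2[OF that(2)]]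
    by (simp add: mult.assoc)
  have split_norm: "(LINT x|?M. (\<sigma> x)\<^sup>2 / ?\<rho>' x + \<rho> x * (norm (v x))\<^sup>2 / g) =
      (LINT x|?M. (\<sigma> x)\<^sup>2 / ?\<rho>' x) + ?c v / g"
    if "\<sigma> \<in> L2 \<Omega>" "v \<in> H_sigma_0 \<Omega>" for \<sigma> v
    using int_\<sigma>[OF that(1)] int_c[OF that(2)] by simp

  text \<open>Young's inequality \<open>-2\<sigma>v\<^sub>3 \<le> \<Lambda>\<sigma>\<^sup>2/\<rho>' + \<rho>'v\<^sub>3\<^sup>2/\<Lambda>\<close> is written below as a complete square.\<close>
  have upper: "Lambda_N \<mu> g \<Omega> \<rho> \<le> ereal \<Lambda>"
    unfolding Lambda_N_def
  proof (rule SUP_least, clarify)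
    fix \<sigma> v assume "(\<sigma>, v) \<in> adm_N g \<Omega> \<rho>"
    then have \<sigma>: "\<sigma> \<in> L2 \<Omega>" and v: "v \<in> H_sigma_0 \<Omega>"
      and one: "(LINT x|?M. (\<sigma> x)\<^sup>2 / ?\<rho>' x) + ?c v / g = 1"
      using split_norm by (auto simp: adm_N_def)
    let ?I = "LINT x|?M. (\<sigma> x)\<^sup>2 / ?\<rho>' x"
    have "(LINT x|?M. - 2 * (\<sigma> x * (v x $ 3))) \<le>
        (LINT x|?M. \<Lambda> * ((\<sigma> x)\<^sup>2 / ?\<rho>' x) + (1 / \<Lambda>) * (?\<rho>' x * (v x $ 3)\<^sup>2))"
    proof (rule integral_mono_AE)
      show "AE x in ?M. - 2 * (\<sigma> x * (v x $ 3)) \<le>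
          \<Lambda> * ((\<sigma> x)\<^sup>2 / ?\<rho>' x) + (1 / \<Lambda>) * (?\<rho>' x * (v x $ 3)\<^sup>2)"
      proof (rule AE_I2)
        fix x assume "x \<in> space ?M"
        then have p: "?\<rho>' x > 0" using pos' by simp
        have "0 \<le> (\<Lambda> * \<sigma> x + ?\<rho>' x * v x $ 3)\<^sup>2 / (\<Lambda> * ?\<rho>' x)"
          using p assms(8) by simp
        also have "\<dots> = \<Lambda> * ((\<sigma> x)\<^sup>2 / ?\<rho>' x) + (1 / \<Lambda>) * (?\<rho>' x * (v x $ 3)\<^sup>2)
            + 2 * (\<sigma> x * (v x $ 3))"
          using p assms(8) by (simp add: field_simps power2_eq_square)
        finally show "- 2 * (\<sigma> x * (v x $ 3)) \<le>
          \<Lambda> * ((\<sigma> x)\<^sup>2 / ?\<rho>' x) + (1 / \<Lambda>) * (?\<rho>' x * (v x $ 3)\<^sup>2)" by simp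
      qed
    qed (intro Bochner_Integration.integrable_add integrable_mult_right int_\<sigma>[OF \<sigma>] int_b[OF v]
        L2_product_integrable[OF \<sigma> H_sigma_0_component_L2[OF v]])+
    then have "- 2 * (LINT x|?M. \<sigma> x * (v x $ 3)) \<le> \<Lambda> * ?I + (1 / \<Lambda>) * ?b v"
      using Bochner_Integration.integral_add[OF integrable_mult_right[OF int_\<sigma>[OF \<sigma>], of \<Lambda>]
          integrable_mult_right[OF int_b[OF v], of "1 / \<Lambda>"]]
      by (simp only: integral_mult_right_zero)
    \<comment> \<open>This is the fixed-point equation, used through \<open>growth_bound\<close>
      with the value \<Lambda>^2 and divided by \<Lambda> g.\<close>
    moreover have "(1 / \<Lambda>) * ?b v - \<mu> * ?a v / g \<le> \<Lambda> * (?c v / g)"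
    proof -
      have "g * ?b v - \<Lambda> * \<mu> * ?a v \<le> \<Lambda>\<^sup>2 * ?c v"
        using growth_bound[OF \<Omega>(1) m0(1) B m assms(3,2,8) _ v, of "\<Lambda>\<^sup>2"] assms(9) by simp
      then have "(g * ?b v - \<Lambda> * \<mu> * ?a v) / (\<Lambda> * g) \<le> \<Lambda>\<^sup>2 * ?c v / (\<Lambda> * g)"
        using assms(3,8) by (intro divide_right_mono) auto
      then show ?thesis
        using assms(3,8) by (simp add: diff_divide_distrib power2_eq_square)
    qed
    \<comment> \<open>The two bounds above add up to \<Lambda> times the constraint integral, which
      is 1.\<close>
    moreover have "\<Lambda> * ?I + \<Lambda> * (?c v / g) = \<Lambda>"
      using arg_cong[OF one, of "\<lambda>z. \<Lambda> * z"] by (simp only: distrib_left mult_1_right)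
    ultimately show "ereal (- (LINT x|?M. \<mu> * (norm (weak_grad \<Omega> v x))\<^sup>2 / g + 2 * \<sigma> x * (v x $ 3)))
        \<le> ereal \<Lambda>"
      unfolding split_value[OF \<sigma> v] by simp
  qed

  text \<open>The competitor is \<open>w\<close> together with the density \<open>-\<rho>'w\<^sub>3/\<Lambda>\<close>, for which Young's
    inequality is an equality, both multiplied by the normalising factor \<open>s\<close>.\<close>
  have lower: "ereal ((g * ?b w - \<Lambda> * \<mu> * ?a w) / \<Lambda>) \<le> Lambda_N \<mu> g \<Omega> \<rho>" if "w \<in> adm \<Omega> \<rho>" for w
  proof -
    have w: "w \<in> H_sigma_0 \<Omega>" and c1: "?c w = 1"
      using that by (auto simp: adm_def)
    have X: "g * ?b w - \<Lambda> * \<mu> * ?a w \<le> \<Lambda>\<^sup>2"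
      using growth_bound[OF \<Omega>(1) m0(1) B m assms(3,2,8) _ w, of "\<Lambda>\<^sup>2"] assms(9) c1 by simp
    have b0: "?b w \<ge> 0"
      using pos' by (intro integral_nonneg_AE AE_I2) (simp add: less_imp_le)
    \<comment> \<open>\<open>t\<close> is the constraint integral of the unscaled pair (-\<rho>' w_3
      / \<Lambda>, w), so the normalising factor is 1 / sqrt t. From t >= 1 / g follows s^2 / g <=
      1, used at the end.\<close>
    define t where "t = ?b w / \<Lambda>\<^sup>2 + 1 / g"
    have t: "t > 0" "1 / t \<le> g"
    proof -
      have "1 / g \<le> t" using b0 by (simp add: t_def)
      moreover have "0 < 1 / g" using assms(3) by simp
      ultimately show "t > 0" by linarith
      with \<open>1 / g \<le> t\<close> show "1 / t \<le> g" using assms(3) by (simp add: field_simps)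
    qed
    define s where "s = 1 / sqrt t"
    have s: "s \<noteq> 0" "s\<^sup>2 = 1 / t"
      using t by (auto simp: s_def power_divide)
    define v where "v = (\<lambda>x. s *\<^sub>R w x)"
    define \<sigma> where "\<sigma> = (\<lambda>x. (- s / \<Lambda>) * (?\<rho>' x * w x $ 3))"
    have v: "v \<in> H_sigma_0 \<Omega>"
      unfolding v_def by (rule H_sigma_0_scale[OF \<Omega>(1) s(1) w])
    have w3: "(\<lambda>x. w x $ 3) \<in> L2 \<Omega>"
      by (rule H_sigma_0_component_L2[OF w])
    have "(\<lambda>x. ?\<rho>' x * w x $ 3) \<in> L2 \<Omega>"
    proof -
      \<comment> \<open>One factor \<rho>' is already contained in \<open>int_b\<close>; its
        boundedness supplies the second.\<close>
      have "integrable ?M (\<lambda>x. ?\<rho>' x * (?\<rho>' x * (w x $ 3)\<^sup>2))"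
        by (intro integrable_bounded_mult[OF m0(2) B'] int_b[OF w])
      moreover have "(\<lambda>x. ?\<rho>' x * w x $ 3) \<in> borel_measurable ?M"
        using w3 by (intro borel_measurable_times m0(2)) (simp add: L2_def)
      ultimately show ?thesis
        by (simp add: L2_def power_mult_distrib power2_eq_square mult_ac)
    qed
    then have \<sigma>: "\<sigma> \<in> L2 \<Omega>"
      unfolding \<sigma>_def by (rule L2_scale)
    have \<sigma>2: "(LINT x|?M. (\<sigma> x)\<^sup>2 / ?\<rho>' x) = s\<^sup>2 * ?b w / \<Lambda>\<^sup>2"
    proof -
      have "(LINT x|?M. (\<sigma> x)\<^sup>2 / ?\<rho>' x) = (LINT x|?M. (s\<^sup>2 / \<Lambda>\<^sup>2) * (?\<rho>' x * (w x $ 3)\<^sup>2))"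
      proof (rule Bochner_Integration.integral_cong)
        fix x assume "x \<in> space ?M"
        then have "?\<rho>' x > 0" using pos' by simp
        then show "(\<sigma> x)\<^sup>2 / ?\<rho>' x = (s\<^sup>2 / \<Lambda>\<^sup>2) * (?\<rho>' x * (w x $ 3)\<^sup>2)"
          unfolding \<sigma>_def by (simp add: power_mult_distrib power_divide power2_eq_square)
      qed simp
      then show ?thesis by simp
    qed
    have \<sigma>v: "(LINT x|?M. \<sigma> x * (v x $ 3)) = - (s\<^sup>2 * ?b w / \<Lambda>)"
    proof -
      have "(LINT x|?M. \<sigma> x * (v x $ 3)) = (LINT x|?M. (- s\<^sup>2 / \<Lambda>) * (?\<rho>' x * (w x $ 3)\<^sup>2))"
        by (simp add: \<sigma>_def v_def power2_eq_square mult_ac)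
      then show ?thesis by simp
    qed
    have "?c v = (LINT x|?M. s\<^sup>2 * (\<rho> x * (norm (w x))\<^sup>2))"
      by (intro Bochner_Integration.integral_cong) (simp_all add: v_def power_mult_distrib)
    then have cv: "?c v = s\<^sup>2"
      using c1 by simp
    have av: "?a v = s\<^sup>2 * ?a w"
      unfolding v_def by (rule weak_grad_scale_square_integral[OF \<Omega>(1) s(1) w])
    have "s\<^sup>2 * ?b w / \<Lambda>\<^sup>2 + s\<^sup>2 / g = 1"
    proof -
      have "s\<^sup>2 * ?b w / \<Lambda>\<^sup>2 + s\<^sup>2 / g = s\<^sup>2 * t"
        by (simp add: t_def distrib_left)
      then show ?thesis using s(2) t(1) by simp
    qed
    then have one: "(LINT x|?M. (\<sigma> x)\<^sup>2 / ?\<rho>' x + \<rho> x * (norm (v x))\<^sup>2 / g) = 1"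
      unfolding split_norm[OF \<sigma> v] \<sigma>2 cv by simp
    then have "(\<sigma>, v) \<in> adm_N g \<Omega> \<rho>"
      using \<sigma> v by (simp add: adm_N_def)
    then have le: "ereal (- (LINT x|?M. \<mu> * (norm (weak_grad \<Omega> v x))\<^sup>2 / g + 2 * \<sigma> x * (v x $ 3)))
        \<le> Lambda_N \<mu> g \<Omega> \<rho>"
      unfolding Lambda_N_def by (rule SUP_upper2) simp
    let ?X = "g * ?b w - \<Lambda> * \<mu> * ?a w"
    \<comment> \<open>The right-hand side will turn out to be the value at the competitor. It is a
      convex combination of \<Lambda> and \<open>?X / \<Lambda>\<close> with weight s^2 / g on the
      latter, and \<open>?X / \<Lambda>\<close> is the smaller of the two.\<close>
    have "?X / \<Lambda> \<le> \<Lambda> + (s\<^sup>2 / g) * (?X / \<Lambda> - \<Lambda>)"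
    proof -
      have "?X / \<Lambda> - \<Lambda> \<le> 0"
        using X assms(8) by (simp add: pos_divide_le_eq power2_eq_square)
      moreover have "s\<^sup>2 / g \<le> 1"
        unfolding s(2) using t(2) assms(3) by (simp only: pos_divide_le_eq mult_1)
      ultimately show ?thesis
        using mult_right_mono_neg[of "s\<^sup>2 / g" 1 "?X / \<Lambda> - \<Lambda>"] by simp
    qed
    \<comment> \<open>Writing 1 as the constraint lets the terms \<Lambda> s^2 / g cancel and
      doubles the term in \<open>?b w\<close>, as the mixed term of the functional requires.\<close>
    also have "\<dots> = \<Lambda> * (s\<^sup>2 * ?b w / \<Lambda>\<^sup>2 + s\<^sup>2 / g) + (s\<^sup>2 / g) * (?X / \<Lambda> - \<Lambda>)"
      using \<open>s\<^sup>2 * ?b w / \<Lambda>\<^sup>2 + s\<^sup>2 / g = 1\<close> by simp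
    also have "\<dots> = - (\<mu> * ?a v / g) - 2 * (LINT x|?M. \<sigma> x * (v x $ 3))"
      unfolding av \<sigma>v using assms(3,8) by (simp add: field_simps power2_eq_square)
    also have "\<dots> = - (LINT x|?M. \<mu> * (norm (weak_grad \<Omega> v x))\<^sup>2 / g + 2 * \<sigma> x * (v x $ 3))"
      by (rule split_value[OF \<sigma> v, symmetric])
    finally have "ereal (?X / \<Lambda>) \<le>
        ereal (- (LINT x|?M. \<mu> * (norm (weak_grad \<Omega> v x))\<^sup>2 / g + 2 * \<sigma> x * (v x $ 3)))"
      by (simp only: ereal_less_eq)
    from order_trans[OF this le] show ?thesis .
  qed

  have "ereal \<Lambda> \<le> Lambda_N \<mu> g \<Omega> \<rho>"
  \<comment> \<open>A priori \<open>Lambda_N\<close> is an extended real, so a real \<open>r\<close>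
    is put between it and \<Lambda>. By \<open>lower\<close> the first functional would be at most
    \<Lambda> r on all of \<open>adm\<close>, while its supremum is \<Lambda>^2 > \<Lambda>
    r.\<close>
  proof (rule ccontr)
    assume "\<not> ereal \<Lambda> \<le> Lambda_N \<mu> g \<Omega> \<rho>"
    then have "Lambda_N \<mu> g \<Omega> \<rho> < ereal \<Lambda>" by (simp only: not_le)
    from ereal_dense2[OF this] obtain r where r: "Lambda_N \<mu> g \<Omega> \<rho> \<le> ereal r" "r < \<Lambda>"
      by (auto intro: less_imp_le)
    have "growth_sup \<mu> g \<Omega> \<rho> \<Lambda> \<le> ereal (\<Lambda> * r)"
      unfolding growth_sup_def
    proof (rule SUP_least)
      fix w assume "w \<in> adm \<Omega> \<rho>"
      from order_trans[OF lower[OF this] r(1)]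
      show "ereal (g * ?b w - \<Lambda> * \<mu> * ?a w) \<le> ereal (\<Lambda> * r)"
        using assms(8) by (simp add: pos_divide_le_eq mult.commute)
    qed
    then have "\<Lambda> * \<Lambda> \<le> \<Lambda> * r"
      by (simp only: assms(9)[symmetric] ereal_less_eq power2_eq_square)
    then show False using assms(8) r(2) by simp
  qed
  with upper show ?thesis by (intro antisym)
qed

end
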